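(* Let $c,d\ge2$ be integers, and set $s_c=\sqrt{c-1}$, $\rho_1=\sqrt{c-1}\sqrt{d-1}$. Let $r\in(-\rho_1^{-1},\rho_1^{-1})$ and $$\gamma=\sqrt{\frac{1-(\rho_1 r)^2}{1+(s_cr)^2}}.$$ Let $(\mathbf{Z}_v)_{v\in V(\mathbb{G}_{d,c})}$ be i.i.d. standard Gaussians, and define $$\mathbf{X}_v=\gamma\sum_{\ell=0}^\infty\sum_{w:\,\mathrm{dist}(w,v)=\ell}r^\ell\mathbf{Z}_w .$$ Then for all $u,v\in V(\mathbb{G}_{d,c})$, writing $h=\mathrm{dist}(u,v)$, $$\mathbb{E}[\mathbf{X}_u\mathbf{X}_v]=r^h\Big(1+\frac{h(1-r)(1+s_c^2r)}{1+(s_cr)^2}\Big).$$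
   Context: $\mathbb{T}_{d,c}$ is the infinite $(c,d)$-biregular tree, with constraint vertices of degree $c$ and variable vertices of degree $d$. $\mathbb{G}_{d,c}$ is its primal graph: the vertices are the variables, and two variables are adjacent iff they share a constraint neighbour. $\mathrm{dist}$ is graph distance in $\mathbb{G}_{d,c}$. *)

theory Defs
  imports "HOL-Probability.Probability"
begin

text \<open>
  Simple undirected graphs, possibly infinite, given by a vertex set and an adjacency
  relation. The notion of tree in Graph-Theory only excludes directed cycles, so in a symmetric
  digraph every edge would already count as a cycle; hence the development below.
\<close>

locale simple_graph =
  fixes V :: "'a set" and adj :: "'a \<Rightarrow> 'a \<Rightarrow> bool"
  assumes adj_in_verts: "adj u v \<Longrightarrow> u \<in> V \<and> v \<in> V"
    and adj_sym: "adj u v \<Longrightarrow> adj v u"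
    and adj_irrefl: "\<not> adj v v"

definition graph_cycle :: "('a \<Rightarrow> 'a \<Rightarrow> bool) \<Rightarrow> 'a list \<Rightarrow> bool" where
  "graph_cycle adj xs \<longleftrightarrow> length xs \<ge> 3 \<and> distinct xs \<and>
     (\<forall>i<length xs. adj (xs ! i) (xs ! ((i + 1) mod length xs)))"

definition vertex_degree :: "('a \<Rightarrow> 'a \<Rightarrow> bool) \<Rightarrow> 'a \<Rightarrow> nat" where
  "vertex_degree adj v = card {w. adj v w}"

text \<open>
  The relation \<open>(adj ^^ n) u v\<close> says that there is a walk with \<open>n\<close> edges from \<open>u\<close> to \<open>v\<close>.
  The value is meaningful only if some such walk exists.
\<close>

definition graph_dist :: "('a \<Rightarrow> 'a \<Rightarrow> bool) \<Rightarrow> 'a \<Rightarrow> 'a \<Rightarrow> nat" where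
  "graph_dist adj u v = (LEAST n. (adj ^^ n) u v)"

locale graph_tree = simple_graph V adj
  for V :: "'a set" and adj :: "'a \<Rightarrow> 'a \<Rightarrow> bool" +
  assumes nonempty: "V \<noteq> {}"
    and connected: "u \<in> V \<Longrightarrow> v \<in> V \<Longrightarrow> adj\<^sup>*\<^sup>* u v"
    and acyclic: "\<not> (\<exists>xs. graph_cycle adj xs)"

text \<open>
  For \<open>c, d \<ge> 2\<close> such a tree has no leaves, so it is infinite; it is then unique up to isomorphism.
  Positive cardinality of a neighbourhood includes its finiteness.
\<close>

locale biregular_tree = graph_tree "Var \<union> Con" adj
  for Var Con :: "'a set" and adj :: "'a \<Rightarrow> 'a \<Rightarrow> bool" and d c :: nat +
  assumes disjoint: "Var \<inter> Con = {}"
    and bipartite: "adj x y \<Longrightarrow> (x \<in> Var \<and> y \<in> Con) \<or> (x \<in> Con \<and> y \<in> Var)"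
    and var_degree: "v \<in> Var \<Longrightarrow> vertex_degree adj v = d"
    and con_degree: "a \<in> Con \<Longrightarrow> vertex_degree adj a = c"

definition primal_adj :: "'a set \<Rightarrow> 'a set \<Rightarrow> ('a \<Rightarrow> 'a \<Rightarrow> bool) \<Rightarrow> 'a \<Rightarrow> 'a \<Rightarrow> bool" where
  "primal_adj Var Con adj u v \<longleftrightarrow>
     u \<in> Var \<and> v \<in> Var \<and> u \<noteq> v \<and> (\<exists>a\<in>Con. adj u a \<and> adj v a)"

definition primal_dist :: "'a set \<Rightarrow> 'a set \<Rightarrow> ('a \<Rightarrow> 'a \<Rightarrow> bool) \<Rightarrow> 'a \<Rightarrow> 'a \<Rightarrow> nat" where
  "primal_dist Var Con adj = graph_dist (primal_adj Var Con adj)"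

text \<open>
  The \<open>k\<close>-th term, as a function of the sample point, of the series defining the process at \<open>v\<close>.
\<close>

definition sphere_term ::
  "'a set \<Rightarrow> 'a set \<Rightarrow> ('a \<Rightarrow> 'a \<Rightarrow> bool) \<Rightarrow> real \<Rightarrow> ('a \<Rightarrow> 'w \<Rightarrow> real) \<Rightarrow> 'a \<Rightarrow> 'w \<Rightarrow> nat \<Rightarrow> real"
where
  "sphere_term Var Con adj r Z v \<omega> k =
     (\<Sum>w\<in>{w \<in> Var. primal_dist Var Con adj w v = k}. r ^ k * Z w \<omega>)"

end

theory Submission
  imports Defs
begin

text \<open>
  By independence and absolute convergence the covariance is \<open>\<gamma>\<^sup>2\<close> times
  \<open>f u v = (\<Sum>w. r ^ (dist w u + dist w v))\<close>. Instead of evaluating this sum, step from \<open>u\<close> to its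
  neighbour \<open>u'\<close> in the direction of \<open>v\<close>: the function \<open>\<lambda>w. r ^ dist w u - r * r ^ dist w u'\<close> is
  supported on those \<open>w\<close> that are not closer to \<open>u'\<close> than to \<open>u\<close>, where \<open>dist w v\<close> is determined by
  \<open>dist w u\<close>. Hence \<open>f u v - r * f u' v\<close> is a geometric series, which gives a linear recursion in the
  distance \<open>h\<close> with solution \<open>f = r ^ h * (f\<^sub>0 + h * const)\<close>.
\<close>

subsection \<open>Distances in trees\<close>

lemma graph_dist_le: "(R ^^ n) x y \<Longrightarrow> graph_dist R x y \<le> n"
  unfolding graph_dist_def by (rule Least_le)

lemma graph_dist_walk:
  assumes "R\<^sup>*\<^sup>* x y" shows "(R ^^ graph_dist R x y) x y"
proof -
  obtain n where "(R ^^ n) x y" using assms rtranclp_imp_relpowp by metis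
  then show ?thesis unfolding graph_dist_def by (rule LeastI)
qed

lemma graph_dist_self [simp]: "graph_dist R x x = 0"
  using graph_dist_le[of 0 R x x] by simp

lemma graph_dist_eq_0: "R\<^sup>*\<^sup>* x y \<Longrightarrow> graph_dist R x y = 0 \<longleftrightarrow> x = y"
  using graph_dist_walk[of R x y] by auto

lemma relpowp_symp:
  assumes "symp R" shows "(R ^^ n) x y \<Longrightarrow> (R ^^ n) y x"
proof (induction n arbitrary: y)
  case (Suc n)
  then obtain z where "(R ^^ n) x z" "R z y" by auto
  with Suc.IH assms have "(R ^^ n) z x" "R y z" by (auto dest: sympD)
  then show ?case by (rule relpowp_Suc_I2[rotated])
qed simp

lemma graph_dist_commute: "symp R \<Longrightarrow> graph_dist R x y = graph_dist R y x"
  unfolding graph_dist_def using relpowp_symp[of R] by metis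

text \<open>When the next vertex \<open>z\<close> already lies on the path built so far, the path is
  cut back to its occurrence of \<open>z\<close> instead of being extended.\<close>

lemma distinct_path_of_rtranclp:
  assumes "R\<^sup>*\<^sup>* x y"
  obtains xs where "xs \<noteq> []" "hd xs = x" "last xs = y" "distinct xs" "successively R xs"
proof -
  from assms have "\<exists>xs. xs \<noteq> [] \<and> hd xs = x \<and> last xs = y \<and> distinct xs \<and> successively R xs"
  proof induction
    case base
    show ?case by (rule exI[of _ "[x]"]) simp
  next
    case (step y z)
    then obtain xs where xs: "xs \<noteq> []" "hd xs = x" "last xs = y" "distinct xs" "successively R xs"
      by blast
    show ?case
    proof (cases "z \<in> set xs")
      case True
      then obtain as bs where "xs = as @ z # bs" by (meson split_list)
      with xs show ?thesis
        by (intro exI[of _ "as @ [z]"])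
          (auto simp: successively_append_iff hd_append split: if_splits)
    next
      case False
      with xs step.hyps show ?thesis
        by (intro exI[of _ "xs @ [z]"]) (auto simp: successively_append_iff)
    qed
  qed
  with that show ?thesis by blast
qed

context graph_tree
begin

abbreviation D :: "'a \<Rightarrow> 'a \<Rightarrow> nat" where "D \<equiv> graph_dist adj"

lemma symp_adj: "symp adj"
  using adj_sym by (auto intro: sympI)

lemma D_commute: "D x y = D y x"
  by (rule graph_dist_commute[OF symp_adj])

lemma D_eq_0: "x \<in> V \<Longrightarrow> y \<in> V \<Longrightarrow> D x y = 0 \<longleftrightarrow> x = y"
  by (rule graph_dist_eq_0[OF connected])

lemma D_walk: "x \<in> V \<Longrightarrow> y \<in> V \<Longrightarrow> (adj ^^ D x y) x y"
  by (rule graph_dist_walk[OF connected])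

lemma D_step: "x \<in> V \<Longrightarrow> adj y z \<Longrightarrow> D x z \<le> Suc (D x y)"
  using D_walk[of x y] adj_in_verts[of y z] by (auto intro!: graph_dist_le)

lemma adj_neq: "adj x y \<Longrightarrow> x \<noteq> y"
  using adj_irrefl by blast

lemma D_adj: "adj x y \<Longrightarrow> D x y = Suc 0"
  using D_step[of x x y] D_eq_0[of x y] adj_in_verts[of x y] adj_neq[of x y] by auto

text \<open>The witness is the last vertex before \<open>y\<close> on a shortest walk from
  \<open>x\<close>.\<close>

lemma ex_closer:
  assumes "x \<in> V" "y \<in> V" "x \<noteq> y"
  obtains z where "adj y z" "D x y = Suc (D x z)"
proof -
  from assms D_eq_0 obtain n where n: "D x y = Suc n" by (metis not0_implies_Suc)
  with D_walk[OF assms(1,2)] obtain z where z: "(adj ^^ n) x z" "adj z y" by auto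
  then have "D x z \<le> n" by (intro graph_dist_le)
  with D_step[OF assms(1) z(2)] n have "D x y = Suc (D x z)" by simp
  with z that show ?thesis by (blast intro: adj_sym)
qed

text \<open>A path between two neighbours of \<open>y\<close> that avoids \<open>y\<close> would
  close up through \<open>y\<close> to a cycle. So deleting \<open>y\<close> puts its neighbours in
  different components.\<close>

lemma neighbours_separated:
  assumes yz: "adj y z" "adj y z'" "z \<noteq> z'"
  shows "\<not> (\<lambda>a b. adj a b \<and> a \<noteq> y \<and> b \<noteq> y)\<^sup>*\<^sup>* z z'"
proof
  let ?R = "\<lambda>a b. adj a b \<and> a \<noteq> y \<and> b \<noteq> y"
  assume "?R\<^sup>*\<^sup>* z z'"
  then obtain xs where xs: "xs \<noteq> []" "hd xs = z" "last xs = z'" "distinct xs" "successively ?R xs"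
    by (rule distinct_path_of_rtranclp)
  have len: "length xs \<ge> 2"
    using xs yz by (cases xs rule: remdups_adj.cases) auto
  have R: "?R (xs ! i) (xs ! Suc i)" if "Suc i < length xs" for i
    using xs(5) that by (auto simp: successively_conv_nth)
  \<comment> \<open>The relation \<open>?R\<close> only constrains edges. As there are at least two
    vertices, each one is an endpoint of an edge; for the last vertex it is the edge before
    it.\<close>
  have "y \<notin> set xs"
  proof
    assume "y \<in> set xs"
    then obtain i where i: "i < length xs" "xs ! i = y" by (meson in_set_conv_nth)
    show False
    proof (cases "Suc i < length xs")
      case True
      with R i show ?thesis by blast
    next
      case False
      with i len R[of "i - 1"] show ?thesis by auto
    qed
  qed
  have "graph_cycle adj (y # xs)"
    unfolding graph_cycle_def
  proof (intro conjI allI impI)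
    show "3 \<le> length (y # xs)" using len by simp
    show "distinct (y # xs)" using xs(4) \<open>y \<notin> set xs\<close> by simp
    fix i assume i: "i < length (y # xs)"
    consider "i = 0" | "i = length xs" | j where "i = Suc j" "Suc j < length xs"
      using i by (cases i) (auto simp: less_Suc_eq)
    then show "adj ((y # xs) ! i) ((y # xs) ! ((i + 1) mod length (y # xs)))"
    proof cases
      case 1
      then show ?thesis using xs yz by (simp add: hd_conv_nth)
    next
      case 2
      then show ?thesis using xs yz len adj_sym by (simp add: last_conv_nth nth_Cons')
    next
      case 3
      then show ?thesis using R[of j] by simp
    qed
  qed
  with acyclic show False by blast
qed

text \<open>Otherwise descending to \<open>x\<close> from \<open>z\<close> and from
  \<open>z'\<close> would join them without meeting \<open>y\<close>. The inequalities are not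
  strict so that a neighbour at equal distance can be excluded as well.\<close>

lemma closer_unique:
  assumes "x \<in> V" and yz: "adj y z" "adj y z'"
    and le: "D x z \<le> D x y" "D x z' \<le> D x y"
  shows "z = z'"
proof (rule ccontr)
  assume "z \<noteq> z'"
  let ?R = "\<lambda>a b. adj a b \<and> a \<noteq> y \<and> b \<noteq> y"
  have V: "y \<in> V" "z \<in> V" "z' \<in> V" using yz adj_in_verts by blast+
  have "x \<noteq> y"
    using le D_eq_0[OF \<open>x \<in> V\<close> \<open>z \<in> V\<close>] adj_neq[OF yz(1)] by auto
  \<comment> \<open>Descend from \<open>t\<close> one unit at a time: all later vertices are
    strictly closer to \<open>x\<close> than \<open>y\<close> is, so none of them is
    \<open>y\<close>.\<close>
  have reach: "?R\<^sup>*\<^sup>* x t" if "t \<in> V" "t \<noteq> y" "D x t \<le> D x y" for t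
    using that
  proof (induction "D x t" arbitrary: t)
    case 0
    with D_eq_0[OF \<open>x \<in> V\<close>] show ?case by auto
  next
    case (Suc n)
    then have "x \<noteq> t" by auto
    with Suc.prems obtain t' where t': "adj t t'" "D x t = Suc (D x t')"
      using ex_closer[OF \<open>x \<in> V\<close>] by metis
    have "t' \<noteq> y" "t' \<in> V" using t' Suc.prems adj_in_verts by auto
    then have "?R\<^sup>*\<^sup>* x t'" using Suc t' by simp
    moreover have "?R t' t" using t' Suc.prems \<open>t' \<noteq> y\<close> adj_sym by blast
    ultimately show ?case by (rule rtranclp.rtrancl_into_rtrancl)
  qed
  have "symp ?R" using adj_sym by (auto intro: sympI)
  moreover have "?R\<^sup>*\<^sup>* x z" using reach[of z] V yz adj_neq le by blast
  ultimately have "?R\<^sup>*\<^sup>* z x" by (metis (no_types, lifting) sympD symp_rtranclp)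
  moreover have "?R\<^sup>*\<^sup>* x z'" using reach[of z'] V yz adj_neq le by blast
  ultimately have "?R\<^sup>*\<^sup>* z z'" by (rule rtranclp_trans)
  with neighbours_separated[OF yz \<open>z \<noteq> z'\<close>] show False by blast
qed

text \<open>If the distances were equal, \<open>z\<close> would coincide with the neighbour of
  \<open>y\<close> that is strictly closer to \<open>x\<close>.\<close>

lemma D_neighbour_cases:
  assumes "x \<in> V" "adj y z"
  shows "D x z = Suc (D x y) \<or> D x y = Suc (D x z)"
proof (cases "D x y = D x z")
  case True
  have V: "y \<in> V" "z \<in> V" using assms adj_in_verts by blast+
  have "x \<noteq> y" using True D_eq_0 V assms adj_neq by metis
  with ex_closer[OF \<open>x \<in> V\<close> \<open>y \<in> V\<close>] obtain t where t: "adj y t" "D x y = Suc (D x t)" by metis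
  with closer_unique[OF assms(1) t(1) assms(2)] True show ?thesis by auto
next
  case False
  with D_step[OF assms(1), of y z] D_step[OF assms(1), of z y] adj_sym[OF assms(2)] assms(2)
  show ?thesis by linarith
qed

lemma D_other_neighbour:
  assumes "x \<in> V" "adj y z" "adj y z'" "z \<noteq> z'" "D x y = Suc (D x z)"
  shows "D x z' = Suc (D x y)"
  using D_neighbour_cases[OF assms(1,3)] closer_unique[OF assms(1-3)] assms by auto

text \<open>The edge \<open>{x, y}\<close> lies on the path from \<open>w\<close> to \<open>v\<close>.\<close>

lemma D_across_edge:
  assumes "adj x y" "w \<in> V" "v \<in> V" "D w x = Suc (D w y)" "D v y = Suc (D v x)"
  shows "D w v = D w x + D v x"
  using assms
proof (induction "D v x" arbitrary: x y)
  case 0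
  then have "v = x" using D_eq_0 adj_in_verts by metis
  then show ?case by simp
next
  case (Suc n)
  have V: "x \<in> V" "y \<in> V" using Suc.prems adj_in_verts by blast+
  have "v \<noteq> x" using Suc.hyps(2) by auto
  \<comment> \<open>Slide the edge one step towards \<open>v\<close>: the induction hypothesis is
    applied to \<open>{x', x}\<close> in place of \<open>{x, y}\<close>.\<close>
  with ex_closer[OF \<open>v \<in> V\<close> \<open>x \<in> V\<close>] obtain x' where x': "adj x x'" "D v x = Suc (D v x')"
    by metis
  have "x' \<noteq> y" using x' Suc.prems by auto
  then have "D w x' = Suc (D w x)" using D_other_neighbour[of w x y x'] Suc.prems x' by metis
  with Suc.hyps(1)[of x' x] Suc.hyps(2) x' Suc.prems adj_sym show ?case by simp
qed

text \<open>For adjacent \<open>x\<close> and \<open>y\<close> this is level \<open>n\<close> of the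
  subtree rooted at \<open>y\<close> that remains when the edge to the parent \<open>x\<close> is
  removed. Distances describe it without mentioning components.\<close>

definition branch :: "'a \<Rightarrow> 'a \<Rightarrow> nat \<Rightarrow> 'a set" where
  "branch x y n = {w \<in> V. D w y = n \<and> D w x = Suc n}"

lemma branch_0: "adj x y \<Longrightarrow> branch x y 0 = {y}"
  using D_eq_0[of _ y] D_adj[of y x] adj_sym[of x y] adj_in_verts[of x y]
  by (auto simp: branch_def)

text \<open>The neighbour of \<open>y\<close> towards \<open>w\<close> cannot be \<open>x\<close>,
  which is farther from \<open>w\<close>. Conversely, if \<open>w\<close> lies behind another
  neighbour, then \<open>x\<close> is farther from \<open>w\<close> than \<open>y\<close>
  is.\<close>

lemma branch_Suc:
  assumes "adj x y"
  shows "branch x y (Suc n) = (\<Union>z\<in>{z. adj y z} - {x}. branch y z n)"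
proof (intro equalityI subsetI)
  fix w assume w: "w \<in> branch x y (Suc n)"
  have "y \<in> V" using assms adj_in_verts by blast
  have "w \<in> V" "w \<noteq> y" using w by (auto simp: branch_def)
  then obtain z where "adj y z" "D w y = Suc (D w z)" using ex_closer \<open>y \<in> V\<close> by metis
  then show "w \<in> (\<Union>z\<in>{z. adj y z} - {x}. branch y z n)"
    using w by (intro UN_I[of z]) (auto simp: branch_def)
next
  fix w assume "w \<in> (\<Union>z\<in>{z. adj y z} - {x}. branch y z n)"
  then obtain z where z: "adj y z" "z \<noteq> x" "w \<in> branch y z n" by blast
  then show "w \<in> branch x y (Suc n)"
    using D_other_neighbour[of w y z x] assms adj_sym by (auto simp: branch_def)
qed

lemma sphere_Suc:
  assumes "y \<in> V"
  shows "{w \<in> V. D w y = Suc n} = (\<Union>z\<in>{z. adj y z}. branch y z n)"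
proof (intro equalityI subsetI)
  fix w assume w: "w \<in> {w \<in> V. D w y = Suc n}"
  then have "w \<in> V" "w \<noteq> y" by auto
  then obtain z where "adj y z" "D w y = Suc (D w z)" using ex_closer \<open>y \<in> V\<close> by metis
  then show "w \<in> (\<Union>z\<in>{z. adj y z}. branch y z n)"
    using w by (intro UN_I[of z]) (auto simp: branch_def)
qed (auto simp: branch_def)

text \<open>The branches are disjoint because only one neighbour of \<open>y\<close> is closer to a
  given vertex.\<close>

lemma card_UN_branch:
  assumes "finite N" "N \<subseteq> {z. adj y z}" "\<And>z. z \<in> N \<Longrightarrow> finite (branch y z n) \<and> card (branch y z n) = K"
  shows "finite (\<Union>z\<in>N. branch y z n) \<and> card (\<Union>z\<in>N. branch y z n) = card N * K"
proof -
  have "branch y z n \<inter> branch y z' n = {}" if "z \<in> N" "z' \<in> N" "z \<noteq> z'" for z z'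
    using closer_unique[of _ y z z'] that assms(2) by (fastforce simp: branch_def)
  then have "card (\<Union>z\<in>N. branch y z n) = (\<Sum>z\<in>N. card (branch y z n))"
    using assms by (intro card_UN_disjoint) auto
  with assms show ?thesis by simp
qed

end

subsection \<open>Biregular trees and their primal graphs\<close>

context biregular_tree
begin

abbreviation dist :: "'a \<Rightarrow> 'a \<Rightarrow> nat" where "dist \<equiv> primal_dist Var Con adj"

lemma adj_Var: "x \<in> Var \<Longrightarrow> adj x y \<Longrightarrow> y \<in> Con"
  using bipartite disjoint by blast

lemma adj_Con: "x \<in> Con \<Longrightarrow> adj x y \<Longrightarrow> y \<in> Var"
  using bipartite disjoint by blast

lemma walk_parity:
  assumes "x \<in> Var" shows "(adj ^^ n) x y \<Longrightarrow> if even n then y \<in> Var else y \<in> Con"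
  using assms
proof (induction n arbitrary: y)
  case (Suc n)
  then obtain z where z: "(adj ^^ n) x z" "adj z y" by auto
  with Suc.IH[OF z(1)] Suc.prems adj_Var[of z y] adj_Con[of z y] show ?case
    by (simp split: if_splits)
qed simp

lemma D_parity:
  assumes "x \<in> Var" "y \<in> Var \<union> Con"
  shows "even (D x y) \<longleftrightarrow> y \<in> Var"
  using walk_parity[OF assms(1) D_walk[of x y]] assms disjoint by (auto split: if_splits)

lemma symp_primal_adj: "symp (primal_adj Var Con adj)"
  by (rule sympI) (auto simp: primal_adj_def)

lemma dist_commute: "dist u v = dist v u"
  unfolding primal_dist_def by (rule graph_dist_commute[OF symp_primal_adj])

lemma primal_walk_imp_D_le:
  assumes "u \<in> Var"
  shows "(primal_adj Var Con adj ^^ n) u v \<Longrightarrow> v \<in> Var \<and> D u v \<le> 2 * n"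
proof (induction n arbitrary: v)
  case 0
  then show ?case using assms by auto
next
  case (Suc n)
  then obtain z where z: "(primal_adj Var Con adj ^^ n) u z" "primal_adj Var Con adj z v" by auto
  then obtain a where "v \<in> Var" "adj z a" "adj a v" by (auto simp: primal_adj_def intro: adj_sym)
  with Suc.IH[OF z(1)] D_step[of u z a] D_step[of u a v] assms show ?case by auto
qed

text \<open>A shortest tree walk is cut into pairs of steps, each through a constraint. Minimality
  makes consecutive variables distinct, as \<open>primal_adj\<close> demands.\<close>

lemma primal_walk_of_D:
  assumes "u \<in> Var" "v \<in> Var"
  shows "D u v = 2 * n \<Longrightarrow> (primal_adj Var Con adj ^^ n) u v"
  using assms(2)
proof (induction n arbitrary: v)
  case 0
  with D_eq_0 assms show ?case by auto
next
  case (Suc n)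
  from Suc.prems have "u \<noteq> v" by auto
  with ex_closer assms Suc.prems obtain a where a: "adj v a" "D u v = Suc (D u a)"
    by (metis UnI1)
  with Suc.prems have "a \<in> Con" "u \<noteq> a" using adj_Var disjoint assms by auto
  with ex_closer[of u a] assms obtain z where z: "adj a z" "D u a = Suc (D u z)"
    by (metis UnI1 UnI2)
  have "z \<in> Var" "z \<noteq> v" using adj_Con \<open>a \<in> Con\<close> z a by auto
  with z a \<open>a \<in> Con\<close> Suc.prems have "primal_adj Var Con adj z v"
    by (auto simp: primal_adj_def intro: adj_sym)
  moreover have "(primal_adj Var Con adj ^^ n) u z" using Suc a z \<open>z \<in> Var\<close> by simp
  ultimately show ?case by auto
qed

lemma D_eq_dist:
  assumes "u \<in> Var" "v \<in> Var" shows "D u v = 2 * dist u v"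
proof -
  obtain n where n: "D u v = 2 * n" using D_parity[of u v] assms by (auto elim: evenE)
  from primal_walk_of_D[OF assms n] have w: "(primal_adj Var Con adj ^^ n) u v" .
  have "dist u v = n"
    unfolding primal_dist_def graph_dist_def
  proof (rule Least_equality)
    show "(primal_adj Var Con adj ^^ n) u v" by (rule w)
    fix m assume "(primal_adj Var Con adj ^^ m) u v"
    with primal_walk_imp_D_le[OF assms(1)] n show "n \<le> m" by force
  qed
  with n show ?thesis by simp
qed

lemma dist_eq_0: "u \<in> Var \<Longrightarrow> v \<in> Var \<Longrightarrow> dist u v = 0 \<longleftrightarrow> u = v"
  using D_eq_0[of u v] D_eq_dist[of u v] by simp

lemma card_neighbours_Var: "v \<in> Var \<Longrightarrow> card {w. adj v w} = d"
  using var_degree by (simp add: vertex_degree_def)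

lemma card_neighbours_Con: "a \<in> Con \<Longrightarrow> card {w. adj a w} = c"
  using con_degree by (simp add: vertex_degree_def)

end

section \<open>Sizes of branches and spheres\<close>

locale proper_biregular_tree = biregular_tree +
  assumes two_le: "2 \<le> c" "2 \<le> d"
begin

text \<open>An infinite set has \<open>card\<close> 0, so a positive degree forces
  finiteness.\<close>

lemma finite_neighbours: "x \<in> Var \<union> Con \<Longrightarrow> finite {w. adj x w}"
  using card_neighbours_Var[of x] card_neighbours_Con[of x] two_le
  by (metis Un_iff card.infinite not_numeral_le_zero)

text \<open>The branching factor over two tree levels, from variable to variable. It equals the
  square of \<open>\<rho>\<close> in the final theorem.\<close>

definition growth :: nat where "growth = (c - 1) * (d - 1)"

text \<open>The constraint \<open>a\<close> has \<open>c - 1\<close> children besides its parent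
  \<open>u\<close>. The size \<open>K\<close> is left abstract so that the lemma serves both within
  the induction for \<open>card_branch\<close> and in the count of spheres afterwards.\<close>

lemma branch_Var_odd:
  assumes "adj u a" "u \<in> Var"
    and "\<And>z. adj a z \<Longrightarrow> z \<noteq> u \<Longrightarrow> finite (branch a z n) \<and> card (branch a z n) = K"
  shows "finite (branch u a (Suc n)) \<and> card (branch u a (Suc n)) = (c - 1) * K"
proof -
  have a: "a \<in> Con" "adj a u" using assms adj_Var adj_sym by auto
  then have "card ({z. adj a z} - {u}) = c - 1"
    by (subst card_Diff_singleton) (auto simp: card_neighbours_Con)
  with a assms show ?thesis
    using card_UN_branch[of "{z. adj a z} - {u}" a n K] finite_neighbours[of a]
    by (auto simp: branch_Suc)
qed

lemma card_branch:
  assumes "adj a u" "a \<in> Con"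
  shows "finite (branch a u (2 * m)) \<and> card (branch a u (2 * m)) = growth ^ m"
  using assms
proof (induction m arbitrary: a u)
  case 0
  then show ?case by (simp add: branch_0)
next
  case (Suc m)
  have u: "u \<in> Var" "adj u a" using Suc.prems adj_Con adj_sym by auto
  have "finite (branch u b (Suc (2 * m))) \<and> card (branch u b (Suc (2 * m))) = (c - 1) * growth ^ m"
    if "adj u b" for b
    using that u Suc.IH adj_Var by (intro branch_Var_odd) auto
  moreover have "card ({z. adj u z} - {a}) = d - 1"
    using u by (subst card_Diff_singleton) (auto simp: card_neighbours_Var)
  ultimately have "finite (branch a u (Suc (Suc (2 * m)))) \<and>
    card (branch a u (Suc (Suc (2 * m)))) = (d - 1) * ((c - 1) * growth ^ m)"
    unfolding branch_Suc[OF Suc.prems(1)]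
    using card_UN_branch[of "{z. adj u z} - {a}" u "Suc (2 * m)" "(c - 1) * growth ^ m"]
      finite_neighbours[of u] u by auto
  moreover have "(d - 1) * ((c - 1) * growth ^ m) = growth ^ Suc m"
    by (simp add: growth_def mult_ac)
  ultimately show ?case by simp
qed

lemma sphere_0: "u \<in> Var \<Longrightarrow> {w \<in> Var. dist w u = 0} = {u}"
  using dist_eq_0 by auto

lemma card_sphere_Suc:
  assumes u: "u \<in> Var"
  shows "finite {w \<in> Var. dist w u = Suc m} \<and>
    card {w \<in> Var. dist w u = Suc m} = d * (c - 1) * growth ^ m"
proof -
  have "{w \<in> Var. dist w u = Suc m} = {w \<in> Var \<union> Con. D w u = Suc (Suc (2 * m))}"
  proof (intro equalityI subsetI)
    fix w assume w: "w \<in> {w \<in> Var \<union> Con. D w u = Suc (Suc (2 * m))}"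
    \<comment> \<open>An even tree distance from a variable excludes constraints, so the tree sphere
      consists of variables only.\<close>
    then have "even (D u w)" by (simp add: D_commute)
    with w u D_parity have "w \<in> Var" by blast
    with w u D_eq_dist[of w u] show "w \<in> {w \<in> Var. dist w u = Suc m}" by auto
  qed (use u D_eq_dist in auto)
  also have "\<dots> = (\<Union>a\<in>{a. adj u a}. branch u a (Suc (2 * m)))"
    using u by (intro sphere_Suc) auto
  finally have *: "{w \<in> Var. dist w u = Suc m} = (\<Union>a\<in>{a. adj u a}. branch u a (Suc (2 * m)))" .
  have "finite (branch u a (Suc (2 * m))) \<and> card (branch u a (Suc (2 * m))) = (c - 1) * growth ^ m"
    if "adj u a" for a
    using that u card_branch adj_Var by (intro branch_Var_odd) auto
  then have "finite {w \<in> Var. dist w u = Suc m} \<and>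
      card {w \<in> Var. dist w u = Suc m} = card {a. adj u a} * ((c - 1) * growth ^ m)"
    unfolding * using finite_neighbours[of u] u by (intro card_UN_branch) auto
  then show ?thesis using card_neighbours_Var[OF u] by simp
qed

lemma finite_sphere: "u \<in> Var \<Longrightarrow> finite {w \<in> Var. dist w u = m}"
  using card_sphere_Suc[of u] sphere_0[of u] by (cases m) auto

text \<open>A bound covering radius 0 too; it supplies the geometric second moments, with constant
  2.\<close>

lemma card_sphere_le:
  assumes "u \<in> Var" shows "card {w \<in> Var. dist w u = m} \<le> 2 * growth ^ m"
proof (cases m)
  case 0
  then show ?thesis using sphere_0[OF assms] by simp
next
  case (Suc n)
  have "d \<le> 2 * (d - 1)" using two_le by simp
  then have "d * (c - 1) * growth ^ n \<le> 2 * (d - 1) * (c - 1) * growth ^ n"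
    by (intro mult_le_mono order_refl)
  with Suc assms card_sphere_Suc[of u n] show ?thesis by (simp add: growth_def mult_ac)
qed

text \<open>
  Let \<open>a\<close> be the constraint shared by the adjacent variables \<open>u\<close> and \<open>u'\<close>. The variables split
  according to the neighbour of \<open>a\<close> in their direction: it is \<open>u\<close> on the near side, \<open>u'\<close> on the
  far side, and another one on the middle side.
\<close>

definition near_side :: "'a \<Rightarrow> 'a \<Rightarrow> 'a set" where
  "near_side u u' = {w \<in> Var. dist w u' = Suc (dist w u)}"

definition middle_side :: "'a \<Rightarrow> 'a \<Rightarrow> 'a set" where
  "middle_side u u' = {w \<in> Var. dist w u' = dist w u}"

definition far_side :: "'a \<Rightarrow> 'a \<Rightarrow> 'a set" where
  "far_side u u' = {w \<in> Var. dist w u = Suc (dist w u')}"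

context
  fixes u u' a
  assumes u: "u \<in> Var" "u' \<in> Var" "u \<noteq> u'" and a: "adj a u" "adj a u'"
begin

lemma a_Con: "a \<in> Con"
  using adj_Var[OF u(1) adj_sym[OF a(1)]] .

text \<open>At most one neighbour of \<open>a\<close> is closer to \<open>w\<close> than
  \<open>a\<close> is. The cases are that \<open>u\<close>, neither of the two, or \<open>u'\<close>
  is that neighbour.\<close>

lemma side_cases:
  assumes w: "w \<in> Var"
  obtains "w \<in> near_side u u'" "D w a = Suc (D w u)" "D w u' = Suc (D w a)"
  | "w \<in> middle_side u u'" "D w u = Suc (D w a)" "D w u' = Suc (D w a)"
  | "w \<in> far_side u u'" "D w a = Suc (D w u')" "D w u = Suc (D w a)"
proof -
  have wV: "w \<in> Var \<union> Con" using w by simp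
  have "D w u = 2 * dist w u" "D w u' = 2 * dist w u'" using D_eq_dist w u by auto
  moreover consider "D w a = Suc (D w u)" "D w u' = Suc (D w a)"
    | "D w u = Suc (D w a)" "D w u' = Suc (D w a)"
    | "D w a = Suc (D w u')" "D w u = Suc (D w a)"
    using D_neighbour_cases[OF wV a(1)] D_neighbour_cases[OF wV a(2)]
      D_other_neighbour[OF wV a u(3)] by metis
  ultimately show ?thesis
    using that w by cases (auto simp: near_side_def middle_side_def far_side_def)
qed

lemma sides_partition:
  "Var = near_side u u' \<union> middle_side u u' \<union> far_side u u'"
  "near_side u u' \<inter> middle_side u u' = {}"
proof -
  have "w \<in> near_side u u' \<union> middle_side u u' \<union> far_side u u'" if "w \<in> Var" for w
    using that by (rule side_cases) auto
  then show "Var = near_side u u' \<union> middle_side u u' \<union> far_side u u'"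
    by (auto simp: near_side_def middle_side_def far_side_def)
qed (auto simp: near_side_def middle_side_def)

text \<open>The near side consists of the even levels of the subtree hanging from \<open>u\<close>
  below \<open>a\<close>.\<close>

lemma card_near_side:
  "finite {w \<in> near_side u u'. dist w u = m} \<and> card {w \<in> near_side u u'. dist w u = m} = growth ^ m"
proof -
  have "{w \<in> near_side u u'. dist w u = m} = branch a u (2 * m)"
  proof (intro equalityI subsetI)
    fix w assume w: "w \<in> {w \<in> near_side u u'. dist w u = m}"
    then have "w \<in> Var" by (auto simp: near_side_def)
    then show "w \<in> branch a u (2 * m)"
      by (rule side_cases)
        (use w u D_eq_dist in \<open>auto simp: near_side_def middle_side_def far_side_def branch_def\<close>)
  next
    fix w assume w: "w \<in> branch a u (2 * m)"
    then have "D u w = 2 * m" "w \<in> Var \<union> Con" by (auto simp: branch_def D_commute)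
    then have "w \<in> Var" using D_parity[of u w] u by simp
    then show "w \<in> {w \<in> near_side u u'. dist w u = m}"
      by (rule side_cases) (use w \<open>w \<in> Var\<close> u D_eq_dist in \<open>auto simp: branch_def\<close>)
  qed
  with card_branch[OF a(1) a_Con] show ?thesis by simp
qed

lemma middle_side_0: "{w \<in> middle_side u u'. dist w u = 0} = {}"
proof -
  have "w = u \<and> w = u'" if "w \<in> middle_side u u'" "dist w u = 0" for w
    using that u dist_eq_0[of w u] dist_eq_0[of w u'] by (auto simp: middle_side_def)
  with u show ?thesis by blast
qed

text \<open>The middle side hangs from the \<open>c - 2\<close> other neighbours of
  \<open>a\<close>. These are at primal distance 1 from \<open>u\<close>, whence the shift in the
  exponent.\<close>

lemma card_middle_side_Suc:
  "finite {w \<in> middle_side u u'. dist w u = Suc m} \<and>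
   card {w \<in> middle_side u u'. dist w u = Suc m} = (c - 2) * growth ^ m"
proof -
  have "{w \<in> middle_side u u'. dist w u = Suc m} =
    (\<Union>z\<in>{z. adj a z} - {u, u'}. branch a z (2 * m))"
  proof (intro equalityI subsetI)
    fix w assume w: "w \<in> {w \<in> middle_side u u'. dist w u = Suc m}"
    then have "w \<in> Var" by (auto simp: middle_side_def)
    then have Da: "D w a = Suc (2 * m)" "D w u = Suc (D w a)" "D w u' = Suc (D w a)"
      by (atomize(full), rule side_cases)
        (use w u D_eq_dist in \<open>auto simp: near_side_def middle_side_def far_side_def\<close>)
    then have "w \<noteq> a" by auto
    then obtain z where z: "adj a z" "D w a = Suc (D w z)"
      using ex_closer[of w a] \<open>w \<in> Var\<close> a_Con by auto
    with Da have "z \<noteq> u" "z \<noteq> u'" "w \<in> branch a z (2 * m)"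
      using \<open>w \<in> Var\<close> by (auto simp: branch_def)
    with z show "w \<in> (\<Union>z\<in>{z. adj a z} - {u, u'}. branch a z (2 * m))" by blast
  next
    fix w assume "w \<in> (\<Union>z\<in>{z. adj a z} - {u, u'}. branch a z (2 * m))"
    then obtain z where z: "adj a z" "z \<noteq> u" "z \<noteq> u'" "w \<in> branch a z (2 * m)" by blast
    then have "D z w = 2 * m" "w \<in> Var \<union> Con" by (auto simp: branch_def D_commute)
    then have "w \<in> Var" using D_parity[of z w] adj_Con[OF a_Con z(1)] by simp
    have *: "D w u = Suc (D w a)" "D w u' = Suc (D w a)" "D w a = Suc (2 * m)"
      using z D_other_neighbour[OF _ z(1) a(1)] D_other_neighbour[OF _ z(1) a(2)]
      by (auto simp: branch_def)
    then show "w \<in> {w \<in> middle_side u u'. dist w u = Suc m}"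
      using \<open>w \<in> Var\<close> D_eq_dist[OF _ u(1), of w] D_eq_dist[OF _ u(2), of w]
      by (auto simp: middle_side_def)
  qed
  moreover have "card ({z. adj a z} - {u, u'}) = c - 2"
    using u a finite_neighbours[of a] a_Con
    by (subst card_Diff_subset) (auto simp: card_neighbours_Con)
  ultimately show ?thesis
    using card_UN_branch[of "{z. adj a z} - {u, u'}" a "2 * m" "growth ^ m"]
      card_branch a_Con finite_neighbours[of a] by auto
qed

text \<open>In both cases the path from \<open>w\<close> to \<open>v\<close> crosses the edge
  \<open>{a, u'}\<close>, so \<open>dist w v = dist w u' + dist v u'\<close>.\<close>

lemma dist_from_far_side:
  assumes v: "v \<in> far_side u u'"
  shows "w \<in> near_side u u' \<Longrightarrow> dist w v = Suc (dist w u + dist v u')"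
    and "w \<in> middle_side u u' \<Longrightarrow> dist w v = dist w u + dist v u'"
proof -
  have "v \<in> Var" using v by (auto simp: far_side_def)
  then have Dv: "D v a = Suc (D v u')"
    by (rule side_cases) (use v in \<open>auto simp: near_side_def middle_side_def far_side_def\<close>)
  have across: "D w v = D w u' + D v u'" if "w \<in> Var" "D w u' = Suc (D w a)" for w
    using D_across_edge[OF adj_sym[OF a(2)], of w v] that Dv \<open>v \<in> Var\<close> by auto
  have "w \<in> Var" "D w u' = Suc (D w a)" if "w \<in> near_side u u' \<or> w \<in> middle_side u u'" for w
  proof -
    show "w \<in> Var" using that by (auto simp: near_side_def middle_side_def)
    then show "D w u' = Suc (D w a)"
      by (rule side_cases) (use that in \<open>auto simp: near_side_def middle_side_def far_side_def\<close>)
  qed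
  note * = this across
  have eq: "dist w v = dist w u' + dist v u'" if "w \<in> near_side u u' \<or> w \<in> middle_side u u'" for w
    using *[of w] that D_eq_dist[of w v] D_eq_dist[of w u'] D_eq_dist[of v u'] u \<open>v \<in> Var\<close>
    by fastforce
  show "w \<in> near_side u u' \<Longrightarrow> dist w v = Suc (dist w u + dist v u')"
    "w \<in> middle_side u u' \<Longrightarrow> dist w v = dist w u + dist v u'"
    using eq[of w] by (auto simp: near_side_def middle_side_def)
qed

end

lemma ex_towards:
  assumes "u \<in> Var" "v \<in> Var" "u \<noteq> v"
  obtains u' a where "u' \<in> Var" "u \<noteq> u'" "adj a u" "adj a u'" "v \<in> far_side u u'"
proof -
  from ex_closer[of v u] assms obtain a where a: "adj u a" "D v u = Suc (D v a)" by auto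
  then have "a \<in> Con" "v \<noteq> a" using adj_Var disjoint assms by auto
  with ex_closer[of v a] assms obtain u' where u': "adj a u'" "D v a = Suc (D v u')" by auto
  then have "u' \<in> Var" "u \<noteq> u'" using adj_Con \<open>a \<in> Con\<close> a by auto
  moreover have "v \<in> far_side u u'"
    using D_eq_dist[of v u] D_eq_dist[of v u'] assms \<open>u' \<in> Var\<close> a u' by (auto simp: far_side_def)
  ultimately show ?thesis using that a u' adj_sym by blast
qed

end

subsection \<open>Sums of powers of distances\<close>

lemma has_sum_Sigma_levels:
  fixes f :: "'a \<Rightarrow> real" and g :: "'a \<Rightarrow> nat"
  shows "((\<lambda>(n, w). f w) has_sum S) (SIGMA n:UNIV. {w \<in> W. g w = n}) \<longleftrightarrow> (f has_sum S) W"
proof -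
  have "bij_betw snd (SIGMA n:UNIV. {w \<in> W. g w = n}) W"
    by (rule bij_betwI[where g = "\<lambda>w. (g w, w)"]) auto
  from has_sum_reindex_bij_betw[OF this, of f S] show ?thesis by (simp add: case_prod_unfold)
qed

lemma sums_levels_of_has_sum:
  fixes f :: "'a \<Rightarrow> real" and g :: "'a \<Rightarrow> nat"
  assumes "(f has_sum S) W" "\<And>n. finite {w \<in> W. g w = n}"
  shows "(\<lambda>n. \<Sum>w\<in>{w \<in> W. g w = n}. f w) sums S"
proof (rule has_sum_imp_sums, rule has_sum_Sigma')
  show "((\<lambda>(n, w). f w) has_sum S) (SIGMA n:UNIV. {w \<in> W. g w = n})"
    using assms(1) by (simp add: has_sum_Sigma_levels)
qed (use assms(2) in \<open>simp add: has_sum_finite\<close>)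

text \<open>Nonnegative terms make the ordered series over levels unconditionally summable, so the
  finite levels can be merged into one sum over \<open>W\<close>.\<close>

lemma has_sum_power_levels:
  fixes t :: real and g :: "'a \<Rightarrow> nat"
  assumes "(\<lambda>n. real (card {w \<in> W. g w = n}) * t ^ n) sums S"
    and fin: "\<And>n. finite {w \<in> W. g w = n}" and "0 \<le> t"
  shows "((\<lambda>w. t ^ g w) has_sum S) W"
proof -
  let ?B = "\<lambda>n. {w \<in> W. g w = n}"
  have level: "((\<lambda>w. t ^ g w) has_sum real (card (?B n)) * t ^ n) (?B n)" for n
    by (rule has_sum_finiteI[OF fin]) simp
  have total: "((\<lambda>n. real (card (?B n)) * t ^ n) has_sum S) UNIV"
    using assms by (intro sums_nonneg_imp_has_sum) auto
  have "((\<lambda>(n, w). t ^ g w) has_sum S) (SIGMA n:UNIV. ?B n)"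
    using level total \<open>0 \<le> t\<close>
    by (intro has_sum_SigmaI[where g = "\<lambda>n. real (card (?B n)) * t ^ n"]
        summable_on_SigmaI[where g = "\<lambda>n. real (card (?B n)) * t ^ n"])
      (auto intro: has_sum_imp_summable)
  then show ?thesis by (simp only: has_sum_Sigma_levels)
qed

text \<open>Level 0 is exceptional both for spheres, where it has size 1, and for the middle side,
  where it is empty; the later sizes are geometric.\<close>

lemma sums_shifted_geometric:
  fixes q t K :: real
  assumes "\<bar>q * t\<bar> < 1" "a 0 = a0" "\<And>n. a (Suc n) = K * q ^ n"
  shows "(\<lambda>n. a n * t ^ n) sums (a0 + K * t / (1 - q * t))"
proof -
  have "(\<lambda>n. K * t * (q * t) ^ n) sums (K * t * (1 / (1 - q * t)))"
    using assms by (intro sums_mult geometric_sums) auto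
  then have "(\<lambda>n. a (Suc n) * t ^ Suc n) sums (K * t / (1 - q * t))"
    by (simp add: assms power_mult_distrib mult_ac)
  then show ?thesis using assms(2) by (subst (asm) sums_Suc_iff) (simp add: add.commute)
qed

section \<open>Generating functions of distances on the primal graph\<close>

context proper_biregular_tree
begin

context
  fixes r :: real
  assumes r: "real growth * r\<^sup>2 < 1"
begin

lemma abs_growth: "\<bar>real growth * r\<^sup>2\<bar> < 1"
  using r by simp

lemma has_sum_Var:
  assumes u: "u \<in> Var"
  shows "((\<lambda>w. (r\<^sup>2) ^ dist w u) has_sum
    (1 + real (d * (c - 1)) * r\<^sup>2 / (1 - real growth * r\<^sup>2))) Var"
  using u sphere_0[OF u] card_sphere_Suc[OF u] finite_sphere[OF u]
  by (intro has_sum_power_levels sums_shifted_geometric abs_growth) auto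

text \<open>The inequality of arithmetic and geometric means dominates the mixed term by two sums
  over a single distance, which \<open>has_sum_Var\<close> evaluates.\<close>

lemma summable_on_pair:
  assumes "u \<in> Var" "v \<in> Var"
  shows "(\<lambda>w. r ^ (dist w u + dist w v)) summable_on Var"
proof -
  have "(\<lambda>w. norm (r ^ (dist w u + dist w v))) summable_on Var"
  proof (rule Infinite_Sum.abs_summable_on_comparison_test')
    show "(\<lambda>w. (r\<^sup>2) ^ dist w u + (r\<^sup>2) ^ dist w v) summable_on Var"
      using assms has_sum_Var by (intro summable_on_add) (auto intro: has_sum_imp_summable)
    fix w
    let ?a = "\<bar>r\<bar> ^ dist w u" and ?b = "\<bar>r\<bar> ^ dist w v"
    have square: "(r\<^sup>2) ^ n = (\<bar>r\<bar> ^ n)\<^sup>2" for n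
      by (metis power2_abs power_mult mult.commute)
    have "2 * (?a * ?b) \<le> ?a\<^sup>2 + ?b\<^sup>2"
      using sum_squares_bound[of ?a ?b] by simp
    moreover have "0 \<le> ?a * ?b" by simp
    ultimately have "?a * ?b \<le> ?a\<^sup>2 + ?b\<^sup>2" by linarith
    then show "norm (r ^ (dist w u + dist w v)) \<le> (r\<^sup>2) ^ dist w u + (r\<^sup>2) ^ dist w v"
      by (simp only: square real_norm_def power_add abs_mult power_abs)
  qed
  then show ?thesis by (rule summable_on_iff_abs_summable_on_real[THEN iffD2])
qed

lemma has_sum_near_side:
  assumes "u \<in> Var" "u' \<in> Var" "u \<noteq> u'" "adj a u" "adj a u'"
  shows "((\<lambda>w. (r\<^sup>2) ^ dist w u) has_sum (1 / (1 - real growth * r\<^sup>2))) (near_side u u')"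
proof (rule has_sum_power_levels)
  have "(\<lambda>n. (real growth * r\<^sup>2) ^ n) sums (1 / (1 - real growth * r\<^sup>2))"
    using abs_growth by (intro geometric_sums) simp
  then show "(\<lambda>n. real (card {w \<in> near_side u u'. dist w u = n}) * (r\<^sup>2) ^ n) sums
      (1 / (1 - real growth * r\<^sup>2))"
    by (simp add: card_near_side[OF assms] power_mult_distrib)
qed (simp_all add: card_near_side[OF assms])

lemma has_sum_middle_side:
  assumes "u \<in> Var" "u' \<in> Var" "u \<noteq> u'" "adj a u" "adj a u'"
  shows "((\<lambda>w. (r\<^sup>2) ^ dist w u) has_sum (real (c - 2) * r\<^sup>2 / (1 - real growth * r\<^sup>2)))
    (middle_side u u')"
proof (rule has_sum_power_levels)
  have "(\<lambda>n. real (card {w \<in> middle_side u u'. dist w u = n}) * (r\<^sup>2) ^ n) sums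
      (0 + real (c - 2) * r\<^sup>2 / (1 - real growth * r\<^sup>2))"
    by (intro sums_shifted_geometric abs_growth)
      (simp_all only: card_middle_side_Suc[OF assms] middle_side_0[OF assms], simp_all)
  then show "(\<lambda>n. real (card {w \<in> middle_side u u'. dist w u = n}) * (r\<^sup>2) ^ n) sums
      (real (c - 2) * r\<^sup>2 / (1 - real growth * r\<^sup>2))" by simp
  show "finite {w \<in> middle_side u u'. dist w u = n}" for n
    by (cases n) (simp_all only: card_middle_side_Suc[OF assms] middle_side_0[OF assms], simp_all)
qed simp

text \<open>
  The function \<open>\<lambda>w. r ^ dist w u - r * r ^ dist w u'\<close> vanishes on the far side, and
  on the other two sides \<open>dist w v\<close> is determined by \<open>dist w u\<close>.
\<close>

lemma infsum_pair_step:
  assumes u: "u \<in> Var" "u' \<in> Var" "u \<noteq> u'" "adj a u" "adj a u'"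
    and v: "v \<in> far_side u u'"
  shows "(\<Sum>\<^sub>\<infinity>w\<in>Var. r ^ (dist w u + dist w v)) =
    r * (\<Sum>\<^sub>\<infinity>w\<in>Var. r ^ (dist w u' + dist w v)) +
    r ^ dist v u * ((1 - r) * (1 + real (c - 1) * r) / (1 - real growth * r\<^sup>2))"
proof -
  define F where "F w = r ^ (dist w u + dist w v) + (- r) * r ^ (dist w u' + dist w v)" for w
  let ?q = "real growth * r\<^sup>2" and ?h = "dist v u'"
  have vV: "v \<in> Var" and vu: "dist v u = Suc ?h" using v by (auto simp: far_side_def)
  have sq: "(r\<^sup>2) ^ n = r ^ (n + n)" for n by (simp add: power_mult[symmetric] mult_2)
  \<comment> \<open>Here \<open>dist w u'\<close> is \<open>dist w u + 1\<close> and
    \<open>dist w v\<close> is \<open>dist w u + ?h + 1\<close>; the two terms of \<open>F\<close>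
    differ by the factor \<open>r^2\<close>.\<close>
  have near: "F w = (1 - r\<^sup>2) * r ^ Suc ?h * (r\<^sup>2) ^ dist w u" if "w \<in> near_side u u'" for w
    using dist_from_far_side(1)[OF u v that] that
    by (simp add: F_def near_side_def sq power_add algebra_simps power2_eq_square)
  have middle: "F w = (1 - r) * r ^ ?h * (r\<^sup>2) ^ dist w u" if "w \<in> middle_side u u'" for w
    using dist_from_far_side(2)[OF u v that] that
    by (simp add: F_def middle_side_def sq power_add algebra_simps)
  have far: "F w = 0" if "w \<in> far_side u u'" for w
    using that by (simp add: F_def far_side_def)
  have "(F has_sum ((1 - r\<^sup>2) * r ^ Suc ?h * (1 / (1 - ?q)))) (near_side u u')"
    by (subst has_sum_cong[OF near]) (assumption, intro has_sum_cmult_right has_sum_near_side[OF u])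
  moreover have "(F has_sum ((1 - r) * r ^ ?h * (real (c - 2) * r\<^sup>2 / (1 - ?q)))) (middle_side u u')"
    by (subst has_sum_cong[OF middle]) (assumption, intro has_sum_cmult_right has_sum_middle_side[OF u])
  ultimately have "(F has_sum ((1 - r\<^sup>2) * r ^ Suc ?h * (1 / (1 - ?q)) +
      (1 - r) * r ^ ?h * (real (c - 2) * r\<^sup>2 / (1 - ?q)))) (near_side u u' \<union> middle_side u u')"
    by (rule has_sum_Un_disjoint) (rule sides_partition(2)[OF u])
  \<comment> \<open>With the common factor \<open>(1 - r) * r ^ Suc ?h\<close> taken out, the
    numerators leave \<open>(1 + r) + (c - 2) * r = 1 + (c - 1) * r\<close>.\<close>
  also have "(1 - r\<^sup>2) * r ^ Suc ?h * (1 / (1 - ?q)) +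
      (1 - r) * r ^ ?h * (real (c - 2) * r\<^sup>2 / (1 - ?q)) =
      r ^ dist v u * ((1 - r) * (1 + real (c - 1) * r) / (1 - ?q))"
  proof -
    have "real (c - 1) = 1 + real (c - 2)" using two_le by simp
    then show ?thesis
      by (simp add: vu add_divide_distrib[symmetric]) (simp add: algebra_simps power2_eq_square)
  qed
  finally have "(F has_sum (r ^ dist v u * ((1 - r) * (1 + real (c - 1) * r) / (1 - ?q)))) Var"
    using sides_partition(1)[OF u] far
    by (subst has_sum_cong_neutral[where T = "near_side u u' \<union> middle_side u u'" and g = F]) auto
  moreover have "(F has_sum ((\<Sum>\<^sub>\<infinity>w\<in>Var. r ^ (dist w u + dist w v)) +
      (- r) * (\<Sum>\<^sub>\<infinity>w\<in>Var. r ^ (dist w u' + dist w v)))) Var"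
    unfolding F_def using u vV summable_on_pair
    by (intro has_sum_add has_sum_cmult_right has_sum_infsum) auto
  ultimately show ?thesis using has_sum_unique by fastforce
qed

text \<open>Each step towards \<open>v\<close> multiplies the remaining sum by \<open>r\<close> and
  adds the same constant times \<open>r ^ dist v u\<close>. Hence the constant is collected once per
  unit of distance.\<close>

lemma infsum_pair:
  assumes "u \<in> Var" and v: "v \<in> Var"
  shows "(\<Sum>\<^sub>\<infinity>w\<in>Var. r ^ (dist w u + dist w v)) =
    r ^ dist v u * ((1 + real (c - 1) * r\<^sup>2) / (1 - real growth * r\<^sup>2) +
      real (dist v u) * ((1 - r) * (1 + real (c - 1) * r) / (1 - real growth * r\<^sup>2)))"
  using assms(1)
proof (induction "dist v u" arbitrary: u)
  case 0
  then have [simp]: "u = v" using dist_eq_0 v by metis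
  have "(\<Sum>\<^sub>\<infinity>w\<in>Var. r ^ (dist w u + dist w v)) = (\<Sum>\<^sub>\<infinity>w\<in>Var. (r\<^sup>2) ^ dist w v)"
    by (simp add: power_mult[symmetric] mult_2)
  also have "\<dots> = 1 + real (d * (c - 1)) * r\<^sup>2 / (1 - real growth * r\<^sup>2)"
    by (rule infsumI[OF has_sum_Var[OF v]])
  also have "\<dots> = (1 + real (c - 1) * r\<^sup>2) / (1 - real growth * r\<^sup>2)"
  proof -
    \<comment> \<open>This splitting lets \<open>growth * r^2\<close> cancel when the fraction is
      combined with 1.\<close>
    have "real (d * (c - 1)) = real growth + real (c - 1)"
      unfolding growth_def using two_le by (cases c; cases d) (simp_all add: algebra_simps)
    with r show ?thesis by (simp add: field_simps)
  qed
  finally show ?case using 0(1) by (simp flip: 0(1))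
next
  case (Suc n)
  have "u \<noteq> v" using Suc.hyps(2) dist_eq_0[of v u] v Suc.prems by auto
  with ex_towards[OF Suc.prems v] obtain u' a where
    u': "u' \<in> Var" "u \<noteq> u'" "adj a u" "adj a u'" "v \<in> far_side u u'" by metis
  then have n: "n = dist v u'" using Suc.hyps(2) by (auto simp: far_side_def)
  show ?case
    unfolding infsum_pair_step[OF Suc.prems u'] Suc.hyps(1)[OF n u'(1)]
    by (simp flip: Suc.hyps(2) n add: algebra_simps add_divide_distrib diff_divide_distrib)
qed

text \<open>Grouping by the total exponent \<open>n\<close> matches the antidiagonals of the Cauchy
  product of the two series.\<close>

lemma sums_pair:
  assumes "u \<in> Var" "v \<in> Var"
  shows "(\<lambda>n. \<Sum>w\<in>{w \<in> Var. dist w u + dist w v = n}. r ^ n) sums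
    (r ^ dist v u * ((1 + real (c - 1) * r\<^sup>2) / (1 - real growth * r\<^sup>2) +
      real (dist v u) * ((1 - r) * (1 + real (c - 1) * r) / (1 - real growth * r\<^sup>2))))"
proof -
  have "finite {w \<in> Var. dist w u + dist w v = n}" for n
    by (rule finite_subset[of _ "\<Union>m\<le>n. {w \<in> Var. dist w u = m}"])
      (auto simp: finite_sphere[OF assms(1)])
  moreover have "((\<lambda>w. r ^ (dist w u + dist w v)) has_sum
      (\<Sum>\<^sub>\<infinity>w\<in>Var. r ^ (dist w u + dist w v))) Var"
    using summable_on_pair[OF assms] by (rule has_sum_infsum)
  ultimately show ?thesis
    using sums_levels_of_has_sum[where g = "\<lambda>w. dist w u + dist w v"] infsum_pair[OF assms]
    by fastforce
qed

end

end

subsection \<open>Products of Gaussian series\<close>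

text \<open>By Tonelli the sum of the norms has finite integral, so it is finite almost
  everywhere.\<close>

lemma AE_summable_norm:
  fixes f :: "nat \<Rightarrow> 'w \<Rightarrow> 'b :: {banach, second_countable_topology}"
  assumes [measurable]: "\<And>k. integrable M (f k)"
    and sm: "summable (\<lambda>k. \<integral>\<omega>. norm (f k \<omega>) \<partial>M)"
  shows "AE \<omega> in M. summable (\<lambda>k. norm (f k \<omega>))"
proof -
  have "(\<integral>\<^sup>+\<omega>. (\<Sum>k. ennreal (norm (f k \<omega>))) \<partial>M) = (\<Sum>k. \<integral>\<^sup>+\<omega>. ennreal (norm (f k \<omega>)) \<partial>M)"
    by (rule nn_integral_suminf) measurable
  also have "\<dots> = (\<Sum>k. ennreal (\<integral>\<omega>. norm (f k \<omega>) \<partial>M))"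
    using assms(1) by (intro suminf_cong nn_integral_eq_integral) auto
  also have "\<dots> = ennreal (\<Sum>k. \<integral>\<omega>. norm (f k \<omega>) \<partial>M)"
    using sm by (intro suminf_ennreal2) auto
  finally have "(\<integral>\<^sup>+\<omega>. (\<Sum>k. ennreal (norm (f k \<omega>))) \<partial>M) \<noteq> \<infinity>" by simp
  then have "AE \<omega> in M. (\<Sum>k. ennreal (norm (f k \<omega>))) \<noteq> \<infinity>"
    by (intro nn_integral_PInf_AE) measurable
  then show ?thesis
    by eventually_elim (auto intro!: summable_suminf_not_top)
qed

text \<open>
  Weighting the inequality \<open>2 |a b| \<le> t a\<^sup>2 + b\<^sup>2 / t\<close> by \<open>t = q ^ j / q ^ i\<close> balances the second moments
  \<open>K * q ^ (2 * i)\<close> and \<open>K * q ^ (2 * j)\<close>.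
\<close>

lemma integral_abs_mult_le:
  fixes f g :: "'w \<Rightarrow> real"
  assumes sq: "integrable M (\<lambda>\<omega>. (f \<omega>)\<^sup>2)" "integrable M (\<lambda>\<omega>. (g \<omega>)\<^sup>2)"
    and fg: "integrable M (\<lambda>\<omega>. f \<omega> * g \<omega>)"
    and le: "(\<integral>\<omega>. (f \<omega>)\<^sup>2 \<partial>M) \<le> K * q ^ (2 * i)" "(\<integral>\<omega>. (g \<omega>)\<^sup>2 \<partial>M) \<le> K * q ^ (2 * j)"
    and "0 < q"
  shows "(\<integral>\<omega>. \<bar>f \<omega> * g \<omega>\<bar> \<partial>M) \<le> K * q ^ (i + j)"
proof -
  define t where "t = q ^ j / q ^ i"
  have "0 < t" using \<open>0 < q\<close> by (simp add: t_def)
  have amgm: "\<bar>a * b\<bar> \<le> (t * a\<^sup>2 + b\<^sup>2 / t) / 2" for a b :: real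
  proof -
    have "0 \<le> (t * \<bar>a\<bar> - \<bar>b\<bar>)\<^sup>2 / t" using \<open>0 < t\<close> by simp
    also have "\<dots> = t * a\<^sup>2 - 2 * \<bar>a * b\<bar> + b\<^sup>2 / t"
      using \<open>0 < t\<close> by (simp add: power2_diff abs_mult diff_divide_distrib add_divide_distrib
          power_mult_distrib) (simp add: power2_eq_square)
    finally show ?thesis by simp
  qed
  have "(\<integral>\<omega>. \<bar>f \<omega> * g \<omega>\<bar> \<partial>M) \<le> (\<integral>\<omega>. (t * (f \<omega>)\<^sup>2 + (g \<omega>)\<^sup>2 / t) / 2 \<partial>M)"
    using sq fg amgm by (intro integral_mono) auto
  also have "\<dots> = (t * (\<integral>\<omega>. (f \<omega>)\<^sup>2 \<partial>M) + (\<integral>\<omega>. (g \<omega>)\<^sup>2 \<partial>M) / t) / 2"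
    using sq by simp
  also have "\<dots> \<le> (t * (K * q ^ (2 * i)) + K * q ^ (2 * j) / t) / 2"
    using le \<open>0 < t\<close> by (intro divide_right_mono add_mono mult_left_mono) auto
  also have "\<dots> = K * q ^ (i + j)"
  proof -
    have "(b / a * (K * (a * a)) + K * (b * b) / (b / a)) / 2 = K * (a * b)"
      if "a \<noteq> 0" "b \<noteq> 0" for a b :: real
      using that by (simp add: field_simps)
    from this[of "q ^ i" "q ^ j"] show ?thesis
      using \<open>0 < q\<close> by (simp only: t_def power_add mult_2 power_not_zero simp_thms)
  qed
  finally show ?thesis .
qed

section \<open>Expectation of a product of two random series\<close>

context prob_space
begin

text \<open>Both series converge absolutely almost surely, so their product is the Cauchy product.
  Its antidiagonal sums have expected absolute value at most \<open>K * (n + 1) * q ^ n\<close>,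
  which is summable and allows termwise integration.\<close>

lemma integral_mult_of_geometric_moments:
  fixes S T :: "nat \<Rightarrow> 'a \<Rightarrow> real"
  assumes S: "\<And>i. integrable M (S i)" "\<And>i. integrable M (\<lambda>\<omega>. (S i \<omega>)\<^sup>2)"
    "\<And>i. expectation (\<lambda>\<omega>. (S i \<omega>)\<^sup>2) \<le> K * q ^ (2 * i)"
    and T: "\<And>i. integrable M (T i)" "\<And>i. integrable M (\<lambda>\<omega>. (T i \<omega>)\<^sup>2)"
    "\<And>i. expectation (\<lambda>\<omega>. (T i \<omega>)\<^sup>2) \<le> K * q ^ (2 * i)"
    and ST: "\<And>i j. integrable M (\<lambda>\<omega>. S i \<omega> * T j \<omega>)"
    and q: "0 < q" "q < 1" and K: "1 \<le> K"
  shows "AE \<omega> in M. summable (\<lambda>k. norm (S k \<omega>))"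
    and "integrable M (\<lambda>\<omega>. (\<Sum>k. S k \<omega>) * (\<Sum>k. T k \<omega>))"
    and "(\<lambda>n. \<Sum>i\<le>n. expectation (\<lambda>\<omega>. S i \<omega> * T (n - i) \<omega>)) sums
      expectation (\<lambda>\<omega>. (\<Sum>k. S k \<omega>) * (\<Sum>k. T k \<omega>))"
proof -
  have AE: "AE \<omega> in M. summable (\<lambda>k. norm (U k \<omega>))"
    if U: "\<And>i. integrable M (U i)" "\<And>i. integrable M (\<lambda>\<omega>. (U i \<omega>)\<^sup>2)"
      "\<And>i. expectation (\<lambda>\<omega>. (U i \<omega>)\<^sup>2) \<le> K * q ^ (2 * i)" for U :: "nat \<Rightarrow> 'a \<Rightarrow> real"
  proof (rule AE_summable_norm[OF U(1)])
    \<comment> \<open>Pair \<open>U i\<close> with the constant 1 at index 0; its second moment 1 is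
      at most \<open>K\<close>.\<close>
    have "expectation (\<lambda>\<omega>. norm (U i \<omega>)) \<le> K * q ^ i" for i
      using integral_abs_mult_le[of M "U i" "\<lambda>_. 1" K q i 0] U K q by (simp add: prob_space)
    moreover have "summable (\<lambda>i. K * q ^ i)"
      using q by (intro summable_mult summable_geometric) simp
    ultimately show "summable (\<lambda>i. expectation (\<lambda>\<omega>. norm (U i \<omega>)))"
      by (rule_tac summable_comparison_test'[where g = "\<lambda>i. K * q ^ i"]) auto
  qed
  show AE_S: "AE \<omega> in M. summable (\<lambda>k. norm (S k \<omega>))" using S by (rule AE)
  have AE_T: "AE \<omega> in M. summable (\<lambda>k. norm (T k \<omega>))" using T by (rule AE)
  define P where "P n \<omega> = (\<Sum>i\<le>n. S i \<omega> * T (n - i) \<omega>)" for n \<omega>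
  have P_int: "integrable M (P n)" for n
    unfolding P_def using ST by auto
  have P_le: "expectation (\<lambda>\<omega>. norm (P n \<omega>)) \<le> K * (real (Suc n) * q ^ n)" for n
  proof -
    have "expectation (\<lambda>\<omega>. norm (P n \<omega>)) \<le> expectation (\<lambda>\<omega>. \<Sum>i\<le>n. \<bar>S i \<omega> * T (n - i) \<omega>\<bar>)"
      using P_int ST unfolding P_def
      by (intro integral_mono) (auto intro!: Bochner_Integration.integrable_sum integrable_abs)
    also have "\<dots> = (\<Sum>i\<le>n. expectation (\<lambda>\<omega>. \<bar>S i \<omega> * T (n - i) \<omega>\<bar>))"
      using ST by (intro Bochner_Integration.integral_sum integrable_abs)
    also have "\<dots> \<le> (\<Sum>i\<le>n. K * q ^ n)"
    proof (rule sum_mono)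
      fix i assume "i \<in> {..n}"
      then show "expectation (\<lambda>\<omega>. \<bar>S i \<omega> * T (n - i) \<omega>\<bar>) \<le> K * q ^ n"
        using integral_abs_mult_le[OF S(2) T(2) ST S(3) T(3) q(1), of i "n - i"] by simp
    qed
    finally show ?thesis by (simp add: mult_ac)
  qed
  have "summable (\<lambda>n. K * (real (Suc n) * q ^ n))"
    using q by (intro summable_mult sums_summable[OF geometric_deriv_sums]) simp
  then have P_sum: "summable (\<lambda>n. expectation (\<lambda>\<omega>. norm (P n \<omega>)))"
    using P_le
    by (rule_tac summable_comparison_test'[where g = "\<lambda>n. K * (real (Suc n) * q ^ n)"]) auto
  note P = P_int AE_summable_norm[OF P_int P_sum] P_sum
  have [measurable]: "S i \<in> borel_measurable M" "T i \<in> borel_measurable M" "P i \<in> borel_measurable M"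
    for i using S(1) T(1) P_int by auto
  have eq: "AE \<omega> in M. (\<Sum>n. P n \<omega>) = (\<Sum>k. S k \<omega>) * (\<Sum>k. T k \<omega>)"
    using AE_S AE_T by eventually_elim (simp only: P_def Cauchy_product)
  show "integrable M (\<lambda>\<omega>. (\<Sum>k. S k \<omega>) * (\<Sum>k. T k \<omega>))"
    using integrable_cong_AE[THEN iffD1, OF _ _ eq integrable_suminf[OF P]] by simp
  have "(\<lambda>n. expectation (P n)) sums expectation (\<lambda>\<omega>. \<Sum>n. P n \<omega>)"
    by (rule sums_integral[OF P])
  also have "expectation (\<lambda>\<omega>. \<Sum>n. P n \<omega>) = expectation (\<lambda>\<omega>. (\<Sum>k. S k \<omega>) * (\<Sum>k. T k \<omega>))"
    by (intro integral_cong_AE eq) auto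
  also have "(\<lambda>n. expectation (P n)) = (\<lambda>n. \<Sum>i\<le>n. expectation (\<lambda>\<omega>. S i \<omega> * T (n - i) \<omega>))"
    unfolding P_def using ST by (intro ext Bochner_Integration.integral_sum)
  finally show "(\<lambda>n. \<Sum>i\<le>n. expectation (\<lambda>\<omega>. S i \<omega> * T (n - i) \<omega>)) sums
      expectation (\<lambda>\<omega>. (\<Sum>k. S k \<omega>) * (\<Sum>k. T k \<omega>))" .
qed

section \<open>Covariances of finite Gaussian sums\<close>

context
  fixes Z :: "'b \<Rightarrow> 'a \<Rightarrow> real" and I :: "'b set"
  assumes indep: "indep_vars (\<lambda>_. borel) Z I"
    and gauss: "\<And>w. w \<in> I \<Longrightarrow> distributed M lborel (Z w) std_normal_density"
begin

lemma gauss_moment: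
  assumes "w \<in> I" shows "integrable M (\<lambda>\<omega>. Z w \<omega> ^ k)"
proof -
  have "integrable lborel (\<lambda>x. std_normal_density x * x ^ k)"
    by (rule integrable_std_normal_moment)
  then show ?thesis
    using distributed_integrable[OF gauss[OF assms], of "\<lambda>x. x ^ k"] by simp
qed

lemma gauss_integrable: "w \<in> I \<Longrightarrow> integrable M (Z w)"
  using gauss_moment[of w 1] by simp

lemma gauss_mult:
  assumes "w \<in> I" "w' \<in> I"
  shows "integrable M (\<lambda>\<omega>. Z w \<omega> * Z w' \<omega>)"
    and "expectation (\<lambda>\<omega>. Z w \<omega> * Z w' \<omega>) = (if w = w' then 1 else 0)"
proof -
  have E: "expectation (Z x) = 0" if "x \<in> I" for x
    using standard_normal_distributed_expectation[OF gauss[OF that]] .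
  have "integrable M (\<lambda>\<omega>. Z w \<omega> * Z w' \<omega>) \<and>
    expectation (\<lambda>\<omega>. Z w \<omega> * Z w' \<omega>) = (if w = w' then 1 else 0)"
  proof (cases "w = w'")
    case True
    then show ?thesis
      using standard_normal_distributed_variance[OF gauss[OF assms(1)]] E[OF assms(1)]
        gauss_moment[OF assms(1), of 2] by (simp add: power2_eq_square)
  next
    case False
    \<comment> \<open>The product over the singleton \<open>{w'}\<close> extracts pairwise
      independence from the independence of the family.\<close>
    then have "indep_var borel (Z w) borel (\<lambda>\<omega>. \<Prod>x\<in>{w'}. Z x \<omega>)"
      using indep_vars_subset[OF indep] assms by (intro indep_vars_prod) auto
    then have "indep_var borel (Z w) borel (Z w')" by simp
    then show ?thesis
      using False E assms gauss_integrable
      by (simp add: indep_var_lebesgue_integral indep_var_integrable)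
  qed
  then show "integrable M (\<lambda>\<omega>. Z w \<omega> * Z w' \<omega>)"
    "expectation (\<lambda>\<omega>. Z w \<omega> * Z w' \<omega>) = (if w = w' then 1 else 0)" by auto
qed

text \<open>The variables are orthonormal, so only the diagonal pairs with \<open>w\<close> in both
  index sets contribute.\<close>

lemma gauss_sum_mult:
  fixes a b :: real
  assumes "finite A" "finite B" "A \<subseteq> I" "B \<subseteq> I"
  shows "integrable M (\<lambda>\<omega>. (\<Sum>w\<in>A. a * Z w \<omega>) * (\<Sum>w\<in>B. b * Z w \<omega>))"
    and "expectation (\<lambda>\<omega>. (\<Sum>w\<in>A. a * Z w \<omega>) * (\<Sum>w\<in>B. b * Z w \<omega>)) = a * b * real (card (A \<inter> B))"
proof -
  have eq: "(\<Sum>w\<in>A. a * Z w \<omega>) * (\<Sum>w\<in>B. b * Z w \<omega>) = (\<Sum>w\<in>A. \<Sum>w'\<in>B. a * b * (Z w \<omega> * Z w' \<omega>))" for \<omega>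
    by (simp add: sum_product mult_ac)
  show "integrable M (\<lambda>\<omega>. (\<Sum>w\<in>A. a * Z w \<omega>) * (\<Sum>w\<in>B. b * Z w \<omega>))"
    unfolding eq using assms gauss_mult(1)
    by (intro Bochner_Integration.integrable_sum integrable_mult_right) auto
  have int: "integrable M (\<lambda>\<omega>. a * b * (Z w \<omega> * Z w' \<omega>))" if "w \<in> A" "w' \<in> B" for w w'
    using gauss_mult(1)[of w w'] that assms by auto
  have "expectation (\<lambda>\<omega>. (\<Sum>w\<in>A. a * Z w \<omega>) * (\<Sum>w\<in>B. b * Z w \<omega>)) =
      (\<Sum>w\<in>A. expectation (\<lambda>\<omega>. \<Sum>w'\<in>B. a * b * (Z w \<omega> * Z w' \<omega>)))"
    unfolding eq using int
    by (intro Bochner_Integration.integral_sum Bochner_Integration.integrable_sum)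
  also have "\<dots> = (\<Sum>w\<in>A. \<Sum>w'\<in>B. expectation (\<lambda>\<omega>. a * b * (Z w \<omega> * Z w' \<omega>)))"
    using int by (intro sum.cong refl Bochner_Integration.integral_sum)
  also have "\<dots> = (\<Sum>w\<in>A. \<Sum>w'\<in>B. if w = w' then a * b else 0)"
  proof (intro sum.cong refl)
    fix w w' assume "w \<in> A" "w' \<in> B"
    then have "w \<in> I" "w' \<in> I" using assms by blast+
    then show "expectation (\<lambda>\<omega>. a * b * (Z w \<omega> * Z w' \<omega>)) = (if w = w' then a * b else 0)"
      by (simp add: gauss_mult(2))
  qed
  also have "\<dots> = a * b * real (card (A \<inter> B))"
    using assms by (simp add: sum.If_cases Int_def)
  finally show "expectation (\<lambda>\<omega>. (\<Sum>w\<in>A. a * Z w \<omega>) * (\<Sum>w\<in>B. b * Z w \<omega>)) =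
      a * b * real (card (A \<inter> B))" .
qed

end

end

subsection \<open>Covariance of the process\<close>

theorem theorem5p4:
  fixes Var Con :: "'a set" and adj :: "'a \<Rightarrow> 'a \<Rightarrow> bool"
    and c d :: nat and s \<rho> r \<gamma> :: real
    and M :: "'w measure" and Z X :: "'a \<Rightarrow> 'w \<Rightarrow> real"
    and u v :: 'a and h :: nat
  assumes "c \<ge> 2" and "d \<ge> 2"
    and tree: "biregular_tree Var Con adj d c"
    and s: "s = sqrt (real c - 1)"
    and \<rho>: "\<rho> = sqrt (real c - 1) * sqrt (real d - 1)"
    and r: "r \<in> {- inverse \<rho> <..< inverse \<rho>}"
    and \<gamma>: "\<gamma> = sqrt ((1 - (\<rho> * r)\<^sup>2) / (1 + (s * r)\<^sup>2))"
    and prob: "prob_space M"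
    and indep: "prob_space.indep_vars M (\<lambda>_. borel) Z Var"
    and gauss: "\<And>w. w \<in> Var \<Longrightarrow> distributed M lborel (Z w) std_normal_density"
    and X: "\<And>w \<omega>. w \<in> Var \<Longrightarrow> \<omega> \<in> space M \<Longrightarrow>
              X w \<omega> = \<gamma> * (\<Sum>k. sphere_term Var Con adj r Z w \<omega> k)"
    and uv: "u \<in> Var" "v \<in> Var"
    and h: "h = primal_dist Var Con adj u v"
  shows "(AE \<omega> in M. summable (sphere_term Var Con adj r Z u \<omega>))
    \<and> integrable M (\<lambda>\<omega>. X u \<omega> * X v \<omega>)
    \<and> (\<integral>\<omega>. X u \<omega> * X v \<omega> \<partial>M)
        = r ^ h * (1 + real h * (1 - r) * (1 + s\<^sup>2 * r) / (1 + (s * r)\<^sup>2))"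
proof -
  interpret prob_space M by (rule prob)
  interpret proper_biregular_tree Var Con adj d c
    using tree assms(1,2) by (intro proper_biregular_tree.intro proper_biregular_tree_axioms.intro)
  let ?S = "\<lambda>x i \<omega>. sphere_term Var Con adj r Z x \<omega> i"
  let ?B = "\<lambda>x i. {w \<in> Var. dist w x = i}"
  have c1: "real (c - 1) = real c - 1" and d1: "real (d - 1) = real d - 1"
    using two_le by simp_all
  have \<rho>2: "\<rho>\<^sup>2 = real growth" and s2: "s\<^sup>2 = real (c - 1)"
    using two_le by (simp_all add: \<rho> s growth_def power_mult_distrib c1 d1)
  have "0 < \<rho>" using two_le by (simp add: \<rho>)
  then have "\<bar>\<rho> * r\<bar> < 1" using r by (auto simp: abs_mult abs_less_iff field_simps)
  then have lt: "real growth * r\<^sup>2 < 1"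
    using abs_square_less_1[of "\<rho> * r"] by (simp add: power_mult_distrib \<rho>2)

  \<comment> \<open>The square of \<open>q\<close> is the midpoint of \<open>growth * r^2\<close>
    and 1. So \<open>q\<close> dominates the growth rate, stays below 1, and is positive even when
    \<open>r = 0\<close>.\<close>
  define q where "q = sqrt ((real growth * r\<^sup>2 + 1) / 2)"
  have q: "0 < q" "q < 1" and q2: "q\<^sup>2 = (real growth * r\<^sup>2 + 1) / 2"
    using lt by (auto simp: q_def add_nonneg_pos)
  have B: "finite (?B x i)" "?B x i \<subseteq> Var" if "x \<in> Var" for x i
    using finite_sphere[OF that] by auto
  note gm = gauss_sum_mult[OF indep gauss]
  have S_eq: "?S x i \<omega> = (\<Sum>w\<in>?B x i. r ^ i * Z w \<omega>)" for x i \<omega>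
    by (simp add: sphere_term_def)
  have int1: "integrable M (?S x i)" if "x \<in> Var" for x i
    unfolding S_eq using gauss_integrable[OF indep gauss] by auto
  have int2: "integrable M (\<lambda>\<omega>. ?S x i \<omega> * ?S y j \<omega>)" if "x \<in> Var" "y \<in> Var" for x y i j
    unfolding S_eq by (rule gm(1)) (use that B in auto)
  have E2: "expectation (\<lambda>\<omega>. ?S x i \<omega> * ?S y j \<omega>) = r ^ i * r ^ j * real (card (?B x i \<inter> ?B y j))"
    if "x \<in> Var" "y \<in> Var" for x y i j
    unfolding S_eq by (rule gm(2)) (use that B in auto)
  have bound: "expectation (\<lambda>\<omega>. (?S x i \<omega>)\<^sup>2) \<le> 2 * q ^ (2 * i)" if "x \<in> Var" for x i
  proof -
    have "real (card (?B x i)) \<le> 2 * real growth ^ i"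
      using of_nat_mono[OF card_sphere_le[OF that, of i], where 'a = real] by simp
    then have "expectation (\<lambda>\<omega>. (?S x i \<omega>)\<^sup>2) \<le> (r\<^sup>2) ^ i * (2 * real growth ^ i)"
      using E2[OF that that, of i i]
      by (auto simp: power2_eq_square power_mult_distrib intro!: mult_left_mono)
    also have "\<dots> = 2 * (real growth * r\<^sup>2) ^ i" by (simp add: power_mult_distrib)
    also have "\<dots> \<le> 2 * (q\<^sup>2) ^ i"
      using lt by (intro mult_left_mono power_mono) (auto simp: q2)
    finally show ?thesis by (simp add: power_mult)
  qed
  have sq: "integrable M (\<lambda>\<omega>. (?S x i \<omega>)\<^sup>2)" if "x \<in> Var" for x i
    using int2[OF that that] by (simp add: power2_eq_square)
  note series = integral_mult_of_geometric_moments
    [of "?S u" 2 q "?S v", OF int1[OF uv(1)] sq[OF uv(1)] bound[OF uv(1)]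
      int1[OF uv(2)] sq[OF uv(2)] bound[OF uv(2)] int2[OF uv] q]

  \<comment> \<open>The sets in the \<open>n\<close>-th antidiagonal are disjoint, as
    \<open>i\<close> is the distance to \<open>u\<close>. Their union consists of the
    \<open>w\<close> with total distance \<open>n\<close>.\<close>
  have "(\<Sum>i\<le>n. expectation (\<lambda>\<omega>. ?S u i \<omega> * ?S v (n - i) \<omega>)) =
      (\<Sum>w\<in>{w \<in> Var. dist w u + dist w v = n}. r ^ n)" for n
  proof -
    have "(\<Sum>i\<le>n. expectation (\<lambda>\<omega>. ?S u i \<omega> * ?S v (n - i) \<omega>)) =
        r ^ n * real (\<Sum>i\<le>n. card (?B u i \<inter> ?B v (n - i)))"
      by (simp add: E2[OF uv] sum_distrib_left power_add[symmetric])
    also have "(\<Sum>i\<le>n. card (?B u i \<inter> ?B v (n - i))) = card (\<Union>i\<le>n. ?B u i \<inter> ?B v (n - i))"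
      using B uv by (subst card_UN_disjoint) auto
    also have "(\<Union>i\<le>n. ?B u i \<inter> ?B v (n - i)) = {w \<in> Var. dist w u + dist w v = n}"
      by auto
    finally show ?thesis by simp
  qed
  with series(3) sums_pair[OF lt uv]
  have E: "expectation (\<lambda>\<omega>. (\<Sum>k. ?S u k \<omega>) * (\<Sum>k. ?S v k \<omega>)) =
      r ^ dist v u * ((1 + real (c - 1) * r\<^sup>2) / (1 - real growth * r\<^sup>2) +
      real (dist v u) * ((1 - r) * (1 + real (c - 1) * r) / (1 - real growth * r\<^sup>2)))"
    by (simp add: sums_iff)
  have XX: "X u \<omega> * X v \<omega> = \<gamma>\<^sup>2 * ((\<Sum>k. ?S u k \<omega>) * (\<Sum>k. ?S v k \<omega>))" if "\<omega> \<in> space M" for \<omega>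
    using X[OF uv(1) that] X[OF uv(2) that] by (simp add: power2_eq_square)
  have pos: "0 < 1 + real (c - 1) * r\<^sup>2" by (simp add: add_pos_nonneg)
  have \<gamma>2: "\<gamma>\<^sup>2 = (1 - real growth * r\<^sup>2) / (1 + real (c - 1) * r\<^sup>2)"
    using lt pos by (simp add: \<gamma> power_mult_distrib \<rho>2 s2)
  have "(\<integral>\<omega>. X u \<omega> * X v \<omega> \<partial>M) = \<gamma>\<^sup>2 * expectation (\<lambda>\<omega>. (\<Sum>k. ?S u k \<omega>) * (\<Sum>k. ?S v k \<omega>))"
    by (simp add: XX cong: Bochner_Integration.integral_cong)
  also have "\<dots> = r ^ h * (1 + real h * (1 - r) * (1 + s\<^sup>2 * r) / (1 + (s * r)\<^sup>2))"
  proof -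
    \<comment> \<open>Here \<open>A\<close> is \<open>1 - growth * r^2\<close> and \<open>B\<close>
      is \<open>1 + (c - 1) * r^2\<close>; the normalisation \<open>\<gamma>\<close> is chosen so
      that its square \<open>A / B\<close> cancels the variance.\<close>
    have "A / B * (p * (B / A + n * (x * y / A))) = p * (1 + n * x * y / B)"
      if "A \<noteq> 0" "B \<noteq> 0" for A B p n x y :: real
      using that by (simp add: field_simps)
    then show ?thesis
      unfolding E \<gamma>2 h power_mult_distrib s2 dist_commute[of u v] using lt pos by simp
  qed
  finally have val: "(\<integral>\<omega>. X u \<omega> * X v \<omega> \<partial>M) =
      r ^ h * (1 + real h * (1 - r) * (1 + s\<^sup>2 * r) / (1 + (s * r)\<^sup>2))" .
  have "integrable M (\<lambda>\<omega>. X u \<omega> * X v \<omega>)"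
    using series(2) by (simp add: XX cong: Bochner_Integration.integrable_cong)
  moreover have "AE \<omega> in M. summable (sphere_term Var Con adj r Z u \<omega>)"
    using series(1) by (auto elim!: eventually_mono intro: summable_norm_cancel)
  ultimately show ?thesis using val by blast
qed

end
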